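(* Let $\mathcal{A}=\{p_1,\ldots,p_k\}$ be a set of polynomials with $p_i\in\mathbb{Z}[x]$ and $p_i(0)=0$ for every $i\in\{1,\ldots,k\}$. Then for any colouring of $\mathbb{Z}$ (with an arbitrary, possibly infinite, set of colours) there exist $a,d\in\mathbb{Z}$ such that the set $\{a,a+p_1(d),\ldots,a+p_k(d)\}$ is either monochromatic or rainbow.
   Context: A colouring of $\mathbb{Z}$ is a function $\chi:\mathbb{Z}\to C$ to some set $C$ of colours. The set $\{a,a+p_1(d),\ldots,a+p_k(d)\}$ is treated as a multiset (list) of $k+1$ entries. It is monochromatic if all its entries receive the same colour, and rainbow if any two of its entries (at different positions of the list) receive different colours. *)

theory Defs
  imports "HOL-Computational_Algebra.Polynomial"
begin

(* Patterns are lists, so an integer hit by several of the polynomials occurs as several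
   entries.  In particular d = 0 gives k + 1 copies of a, which is monochromatic for every
   colouring; and if the zero polynomial is among the ps, no pattern is rainbow. *)
definition poly_pattern :: "int poly list \<Rightarrow> int \<Rightarrow> int \<Rightarrow> int list" where
  "poly_pattern ps a d = a # map (\<lambda>p. a + poly p d) ps"

definition monochromatic :: "('a \<Rightarrow> 'c) \<Rightarrow> 'a list \<Rightarrow> bool" where
  "monochromatic \<chi> xs \<longleftrightarrow> (\<forall>x\<in>set xs. \<forall>y\<in>set xs. \<chi> x = \<chi> y)"

definition rainbow :: "('a \<Rightarrow> 'c) \<Rightarrow> 'a list \<Rightarrow> bool" where
  "rainbow \<chi> xs \<longleftrightarrow> distinct (map \<chi> xs)"

end

theory Submission
  imports Defs "HOL-Library.Multiset" "HOL-Library.Product_Lexorder" "HOL-Library.Countable"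
begin

text \<open>
  Colour a point (a, d) of the integer plane by the set of coincidences among the colours of
  a + p(d), where p is 0 or one of the given polynomials. Finitely many colours occur, and a
  polynomial recurrence theorem for the maps (x, d) |-> (x + G(d, e), d + s(e)), which generate a
  nilpotent group, yields a point (x, d) and e > 0 such that the colour does not change under any
  of finitely many prescribed maps. If the colour is the empty set, the pattern at (x, d) is rainbow.
  Otherwise p and r coincide throughout the structure, so colours are unchanged by shifts
  Q(d + s(e)) - Q(d + t(e)) with Q = p - r. Iterated differences of Q of degree n + 1 produce every
  shift (n + 1)! lc(Q) e^n h(e) with h(0) = 0, in particular q(b) for b = (n + 1)! lc(Q) e^(n + 1) and
  every given q, which makes the pattern with difference b monochromatic.

  The recurrence theorem is proved by colour focusing and induction on the leading terms of the
  family of maps, as in Walters' proof of the polynomial van der Waerden theorem. Conjugation by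
  a group element only alters terms below the leading one, so non-commutativity does no harm.
\<close>

section \<open>Polynomials in two variables\<close>

text \<open>The outer variable of G is d and the inner one, in the coefficients, is the parameter e.\<close>

definition ev :: "int poly poly \<Rightarrow> int \<Rightarrow> int \<Rightarrow> int" where
  "ev G d e = poly (poly G [:d:]) e"

lemma ev_add [simp]: "ev (G + H) d e = ev G d e + ev H d e"
  and ev_diff [simp]: "ev (G - H) d e = ev G d e - ev H d e"
  and ev_mult [simp]: "ev (G * H) d e = ev G d e * ev H d e"
  and ev_0 [simp]: "ev 0 d e = 0"
  and ev_pCons [simp]: "ev (pCons c G) d e = poly c e + d * ev G d e"
  by (simp_all add: ev_def)

lemma ev_pcompose [simp]: "ev (pcompose G H) d e = ev G (ev H d e) e"
  by (induction G) (simp_all add: pcompose_pCons)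

lemma ev_eq_poly: "ev G d e = poly (map_poly (\<lambda>c. poly c e) G) d"
  by (induction G) (simp_all add: map_poly_pCons)

definition lift :: "int poly \<Rightarrow> int poly poly" where
  "lift P = map_poly (\<lambda>c. [:c:]) P"

lemma ev_lift [simp]: "ev (lift P) d e = poly P d"
  unfolding lift_def by (induction P) (simp_all add: map_poly_pCons)

definition shift_param :: "int \<Rightarrow> int poly poly \<Rightarrow> int poly poly" where
  "shift_param t G = map_poly (\<lambda>c. pcompose c [:t, 1:]) G"

definition fix_param :: "int \<Rightarrow> int poly poly \<Rightarrow> int poly poly" where
  "fix_param t G = map_poly (\<lambda>c. [:poly c t:]) G"

lemma ev_shift_param [simp]: "ev (shift_param t G) d e = ev G d (t + e)"
  unfolding shift_param_def by (induction G) (simp_all add: map_poly_pCons poly_pcompose)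

lemma ev_fix_param [simp]: "ev (fix_param t G) d e = ev G d t"
  unfolding fix_param_def by (induction G) (simp_all add: map_poly_pCons)

lemma coeff_shift_param: "coeff (shift_param t G) m = pcompose (coeff G m) [:t, 1:]"
  by (simp add: shift_param_def coeff_map_poly)

lemma coeff_fix_param: "coeff (fix_param t G) m = [:poly (coeff G m) t:]"
  by (simp add: fix_param_def coeff_map_poly)

lemma coeff_pcompose_monic_linear:
  fixes p :: "'a::idom poly"
  assumes "degree p \<le> n"
  shows "coeff (pcompose p [:c, 1:]) n = coeff p n"
proof (cases "n = degree p")
  case True
  have "lead_coeff (pcompose p [:c, 1:]) = lead_coeff p"
    by (subst lead_coeff_comp) simp_all
  moreover have "degree (pcompose p [:c, 1:]) = degree p"
    by (simp add: degree_pcompose)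
  ultimately show ?thesis using True by simp
next
  case False
  with assms show ?thesis by (simp add: coeff_eq_0 degree_pcompose)
qed

text \<open>The shift by \<open>t\<close> leaves the top coefficient alone, and the subtracted
  constant only reaches index 0. If \<open>n = 0\<close>, then \<open>c\<close> is a constant
  vanishing at 0, so all terms are 0.\<close>

lemma coeff_difference_top:
  fixes c :: "int poly"
  assumes "poly c 0 = 0" "degree c \<le> n"
  shows "coeff (pcompose c [:t, 1:]) n - coeff [:poly c t:] n = coeff c n"
proof (cases n)
  case 0
  then obtain a where "c = [:a:]" using assms(2) by (auto elim: degree_eq_zeroE)
  then have "c = 0" using assms(1) by simp
  then show ?thesis by simp
next
  case (Suc k)
  then show ?thesis using coeff_pcompose_monic_linear[OF assms(2)] by simp
qed

section \<open>Polynomial moves and their leading terms\<close>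

type_synonym poly_move = "int poly \<times> int poly poly"

fun move :: "poly_move \<Rightarrow> int \<Rightarrow> int \<times> int \<Rightarrow> int \<times> int" where
  "move (s, G) e (x, d) = (x + ev G d e, d + poly s e)"

fun move_inv :: "poly_move \<Rightarrow> int \<Rightarrow> int \<times> int \<Rightarrow> int \<times> int" where
  "move_inv (s, G) e (x, d) = (x - ev G (d - poly s e) e, d - poly s e)"

text \<open>These are the moves that are the identity at e = 0, the analogue of polynomials without
  constant term.\<close>

fun null :: "poly_move \<Rightarrow> bool" where
  "null (s, G) \<longleftrightarrow> poly s 0 = 0 \<and> (\<forall>d. ev G d 0 = 0)"

lemma null_coeff:
  assumes "\<forall>d. ev G d 0 = 0"
  shows "poly (coeff G m) 0 = 0"
proof -
  from assms have "map_poly (\<lambda>c. poly c 0) G = 0"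
    by (simp add: ev_eq_poly poly_all_0_iff_0)
  then have "coeff (map_poly (\<lambda>c. poly c 0) G) m = 0" by simp
  then show ?thesis by (simp add: coeff_map_poly)
qed

lemma move_0: "null g \<Longrightarrow> move g 0 z = z"
  by (cases g; cases z) simp

text \<open>A group that contains every move at a fixed parameter. The points found by recurrence
  are images under such maps, and conjugating a move by one of them gives a move again.\<close>

definition unip :: "(int \<times> int \<Rightarrow> int \<times> int) \<Rightarrow> bool" where
  "unip a \<longleftrightarrow> (\<exists>\<sigma> P. a = (\<lambda>(x, d). (x + poly P d, d + \<sigma>)))"

lemma unip_id: "unip id"
  unfolding unip_def by (rule exI[of _ 0], rule exI[of _ 0]) auto

lemma unip_comp:
  assumes "unip a" "unip b"
  shows "unip (a \<circ> b)"
proof -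
  from assms obtain \<sigma> P \<tau> Q where "a = (\<lambda>(x, d). (x + poly P d, d + \<sigma>))"
    "b = (\<lambda>(x, d). (x + poly Q d, d + \<tau>))"
    unfolding unip_def by auto
  then show ?thesis unfolding unip_def
    by (intro exI[of _ "\<tau> + \<sigma>"] exI[of _ "Q + pcompose P [:\<tau>, 1:]"])
       (auto simp: fun_eq_iff poly_pcompose algebra_simps)
qed

lemma unip_move_inv: "unip (move_inv g e)"
proof (cases g)
  case (Pair s G)
  then show ?thesis unfolding unip_def
    by (intro exI[of _ "- poly s e"]
          exI[of _ "- pcompose (map_poly (\<lambda>c. poly c e) G) [:- poly s e, 1:]"])
       (auto simp: fun_eq_iff poly_pcompose ev_eq_poly algebra_simps)
qed

fun mcoeff :: "poly_move \<Rightarrow> nat \<times> nat \<times> nat \<Rightarrow> int" where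
  "mcoeff (s, G) (t, m, n) =
     (if t = 0 then coeff (coeff G m) n else if t = 1 \<and> m = 0 then coeff s n else 0)"

lemma finite_mcoeff_support: "finite {i. mcoeff g i \<noteq> 0}"
proof (cases g)
  case (Pair s G)
  let ?A = "(\<Union>m\<in>{..degree G}. (\<lambda>n. (0::nat, m, n)) ` {..degree (coeff G m)})
             \<union> (\<lambda>n. (1, 0, n)) ` {..degree s}"
  have "i \<in> ?A" if "mcoeff g i \<noteq> 0" for i
  proof -
    obtain t m n where i: "i = (t, m, n)" by (cases i) auto
    show ?thesis
    proof (cases "t = 0")
      case True
      then have "coeff (coeff G m) n \<noteq> 0" using that i Pair by simp
      then have "m \<le> degree G" "n \<le> degree (coeff G m)"
        by (auto intro!: le_degree)
      then show ?thesis using i True by auto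
    next
      case False
      then have "t = 1" "m = 0" "coeff s n \<noteq> 0" using that i Pair by (auto split: if_splits)
      then show ?thesis using i by (auto intro: le_degree)
    qed
  qed
  then have "{i. mcoeff g i \<noteq> 0} \<subseteq> ?A" by blast
  then show ?thesis by (rule finite_subset) auto
qed

lemma mcoeff_eq_0D:
  assumes "\<And>i. mcoeff g i = 0"
  shows "g = (0, 0)"
proof (cases g)
  case (Pair s G)
  have "coeff s n = 0" for n using assms[of "(1, 0, n)"] Pair by simp
  moreover have "coeff (coeff G m) n = 0" for m n using assms[of "(0, m, n)"] Pair by simp
  ultimately show ?thesis using Pair by (simp add: poly_eq_iff)
qed

text \<open>
  The indices (1, 0, n) and (0, m, n) stand for the monomials e^n of s and d^m e^n of G, ordered
  lexicographically; thus every monomial of s outranks every monomial of G.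
\<close>

definition wt :: "poly_move \<Rightarrow> nat \<times> nat \<times> nat" where
  "wt g = Max {i. mcoeff g i \<noteq> 0}"

lemma le_wt: "mcoeff g i \<noteq> 0 \<Longrightarrow> i \<le> wt g"
  unfolding wt_def using finite_mcoeff_support by (intro Max_ge) auto

lemma mcoeff_wt: "g \<noteq> (0, 0) \<Longrightarrow> mcoeff g (wt g) \<noteq> 0"
  unfolding wt_def using Max_in[OF finite_mcoeff_support[of g]] mcoeff_eq_0D[of g] by auto

lemma wt_eqI:
  assumes "mcoeff g i \<noteq> 0" "\<And>j. i < j \<Longrightarrow> mcoeff g j = 0"
  shows "wt g = i"
  unfolding wt_def using assms finite_mcoeff_support
  by (intro Max_eqI) (auto intro: leI)

text \<open>Solved for \<open>h\<close>, the identity gives the product of the inverse of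
  \<open>g\<close> at \<open>t\<close>, \<open>g\<close> at \<open>e + t\<close> and the inverse of
  \<open>g1\<close> at \<open>e\<close>, conjugated by \<open>a\<close>. From \<open>wt g\<close>
  upwards the factors commute, \<open>g\<close> at \<open>t\<close> contributes nothing and the
  conjugation is invisible.\<close>

lemma twisted_move:
  assumes a: "unip a" and g: "null g" "g \<noteq> (0, 0)" and g1: "null g1" and le: "wt g1 \<le> wt g"
  obtains h where "null h"
    "\<And>e z. move g t (a (move h e z)) = move g (e + t) (move_inv g1 e (a z))"
    "\<And>i. wt g \<le> i \<Longrightarrow> mcoeff h i = mcoeff g i - mcoeff g1 i"
proof -
  from a obtain \<sigma> P where a: "a = (\<lambda>(x, d). (x + poly P d, d + \<sigma>))"
    unfolding unip_def by auto
  obtain s G where gG: "g = (s, G)" by (cases g)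
  obtain s1 G1 where g1G: "g1 = (s1, G1)" by (cases g1)
  \<comment> \<open>\<open>s'\<close> and \<open>G'\<close> are read off from the second and the
    first coordinate of the identity; \<open>L\<close> is d + \<sigma> - s1(e), the second
    coordinate after \<open>a\<close> and the inverse of \<open>g1\<close>.\<close>
  define s' where "s' = pcompose s [:t, 1:] - [:poly s t:] - s1"
  define L where "L = [:[:\<sigma>:] - s1, 1:]"
  define G' where "G' = lift P - pcompose (lift P) [:s', 1:] - pcompose G1 L
     + pcompose (shift_param t G) L - pcompose (fix_param t G) [:[:\<sigma>:] + s', 1:]"
  have s': "poly s' e = poly s (t + e) - poly s t - poly s1 e" for e
    by (simp add: s'_def poly_pcompose)
  have "null (s', G')"
    using g g1 by (auto simp: gG g1G s' G'_def L_def)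
  moreover have "move g t (a (move (s', G') e z)) = move g (e + t) (move_inv g1 e (a z))" for e z
    by (cases z) (simp add: gG g1G a s' G'_def L_def algebra_simps)
  moreover have "mcoeff (s', G') i = mcoeff g i - mcoeff g1 i" if i: "wt g \<le> i" for i
  proof -
    obtain u m n where iu: "i = (u, m, n)" by (cases i) auto
    show ?thesis
    proof (cases "s = 0")
      \<comment> \<open>Here \<open>wt g\<close> indexes a monomial of \<open>s\<close>, so only
        coefficients of \<open>s'\<close> are compared.\<close>
      case False
      then have "mcoeff g (1, 0, degree s) \<noteq> 0" by (simp add: gG)
      then have "(1, 0, degree s) \<le> (u, m, n)" using le_wt i iu order_trans by blast
      then have "u > 1 \<or> u = 1 \<and> (m > 0 \<or> m = 0 \<and> degree s \<le> n)" by auto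
      then show ?thesis using coeff_difference_top[of s n t] g
        by (auto simp: iu gG g1G s'_def)
    next
      case True
      have "G \<noteq> 0" using g gG True by auto
      have "fst (wt g) = 0" using mcoeff_wt[OF g(2)] True gG
        by (cases "wt g") (auto split: if_splits)
      \<comment> \<open>Since \<open>g\<close> does not move d, \<open>wt g1 \<le> wt g\<close>
        forbids \<open>g1\<close> to do so. Then \<open>P\<close> cancels and \<open>G'\<close> is
        \<open>K\<close> with d shifted by \<sigma>.\<close>
      have s1: "s1 = 0"
      proof (rule ccontr)
        assume "s1 \<noteq> 0"
        then have "mcoeff g1 (1, 0, degree s1) \<noteq> 0" by (simp add: g1G)
        then have "(1, 0, degree s1) \<le> wt g" using le_wt le order_trans by blast
        with \<open>fst (wt g) = 0\<close> show False by (cases "wt g") auto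
      qed
      have s'0: "s' = 0" by (simp add: s'_def True s1)
      define K where "K = shift_param t G - fix_param t G - G1"
      have G': "G' = pcompose K [:[:\<sigma>:], 1:]"
        by (simp add: G'_def s'0 s1 L_def K_def pcompose_diff pcompose_add algebra_simps)
      show ?thesis
      proof (cases "u = 0")
        case False
        then show ?thesis by (auto simp: iu gG g1G True s1 s'0)
      next
        case u: True
        have "mcoeff g (0, degree G, degree (lead_coeff G)) \<noteq> 0"
          using \<open>G \<noteq> 0\<close> by (simp add: gG)
        then have "(0, degree G, degree (lead_coeff G)) \<le> (0::nat, m, n)"
          by (rule order_trans[OF le_wt i[unfolded iu u]])
        then have mn: "degree G \<le> m" "degree (coeff G m) \<le> n"
          by (auto simp: coeff_eq_0 le_less)
        have G10: "coeff G1 m' = 0" if "m' > m" for m'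
        proof (rule ccontr)
          assume "coeff G1 m' \<noteq> 0"
          then have "mcoeff g1 (0, m', degree (coeff G1 m')) \<noteq> 0" by (simp add: g1G)
          then have "(0, m', degree (coeff G1 m')) \<le> (0::nat, m, n)"
            by (rule order_trans[OF order_trans[OF le_wt le] i[unfolded iu u]])
          with that show False by auto
        qed
        have "degree K \<le> m"
          using mn G10 by (intro degree_le)
            (auto simp: K_def coeff_shift_param coeff_fix_param coeff_eq_0)
        then have "coeff G' m = coeff K m"
          unfolding G' by (rule coeff_pcompose_monic_linear)
        then show ?thesis
          using coeff_difference_top[OF null_coeff mn(2), of t] g
          by (simp add: iu u gG g1G K_def coeff_shift_param coeff_fix_param)
      qed
    qed
  qed
  ultimately show ?thesis using that by blast
qed

section \<open>Leading terms and the complexity of a family\<close>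

definition lead :: "poly_move \<Rightarrow> (nat \<times> nat \<times> nat) \<times> int" where
  "lead g = (wt g, mcoeff g (wt g))"

text \<open>For each weight this counts the distinct leading coefficients; moves that share a
  leading term count once. It is the weight of PET induction.\<close>

definition complexity :: "poly_move set \<Rightarrow> (nat \<times> nat \<times> nat) multiset" where
  "complexity F = image_mset fst (mset_set (lead ` F))"

text \<open>Subtracting \<open>g1\<close> keeps leading terms above \<open>wt g1\<close>, translates
  the coefficients at that weight, and pushes moves with the leading term of \<open>g1\<close> below
  it. One copy of \<open>wt g1\<close> is lost and only smaller weights are gained.\<close>

lemma complexity_decreases:
  assumes F: "finite F" "(0, 0) \<notin> F" and g1: "g1 \<in> F" and min: "\<And>g. g \<in> F \<Longrightarrow> wt g1 \<le> wt g"
    and H: "finite H" "(0, 0) \<notin> H"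
    and top: "\<And>h. h \<in> H \<Longrightarrow> \<exists>g\<in>F. \<forall>i\<ge>wt g. mcoeff h i = mcoeff g i - mcoeff g1 i"
  shows "(complexity H, complexity F) \<in> mult {(x, y). x < y}"
proof -
  define w where "w = wt g1"
  define c where "c = mcoeff g1 w"
  define A where "A = {l \<in> lead ` H. w \<le> fst l}"
  define B where "B = {l \<in> lead ` H. \<not> w \<le> fst l}"
  \<comment> \<open>injects the leading terms of H of weight at least w into those of F other than that of g1\<close>
  define \<phi> where "\<phi> = (\<lambda>l :: (nat \<times> nat \<times> nat) \<times> int. (fst l, if fst l = w then snd l + c else snd l))"
  have above: "mcoeff g j = 0" if "wt g < j" for g j
    using le_wt[of g j] that by (meson leD)
  have nz: "mcoeff g (wt g) \<noteq> 0" if "g \<in> F" for g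
    using that F(2) by (intro mcoeff_wt) auto
  have fin: "finite A" "finite B" using H by (auto simp: A_def B_def)
  have "inj \<phi>" by (rule injI) (auto simp: \<phi>_def prod_eq_iff split: if_splits)
  have sub: "\<phi> ` A \<subseteq> lead ` F - {lead g1}"
  proof
    fix l assume "l \<in> \<phi> ` A"
    then obtain h where h: "h \<in> H" "w \<le> wt h" "l = \<phi> (lead h)"
      by (auto simp: A_def lead_def)
    from top[OF h(1)] obtain g where g: "g \<in> F"
      and eq: "\<And>i. wt g \<le> i \<Longrightarrow> mcoeff h i = mcoeff g i - mcoeff g1 i" by blast
    have wg: "w \<le> wt g" using min g by (simp add: w_def)
    have zero: "mcoeff h j = 0" if "wt g < j" for j
      using eq[of j] above[of g j] above[of g1 j] wg that by (auto simp: w_def)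
    show "l \<in> lead ` F - {lead g1}"
    proof (cases "wt g = w")
      case False
      with wg have lt: "w < wt g" by simp
      then have "mcoeff h (wt g) = mcoeff g (wt g)"
        using eq[of "wt g"] above[of g1 "wt g"] by (simp add: w_def)
      moreover from this have "wt h = wt g" using nz[OF g] zero by (intro wt_eqI) auto
      ultimately have "l = lead g" using h(3) False by (simp add: \<phi>_def lead_def)
      moreover have "lead g \<noteq> lead g1" using False by (auto simp: lead_def w_def)
      ultimately show ?thesis using g by auto
    next
      case True
      have hw: "mcoeff h w = mcoeff g w - c" using eq[of w] True by (simp add: c_def)
      \<comment> \<open>Coefficients of \<open>h\<close> above \<open>w\<close> vanish and
        \<open>w \<le> wt h\<close>, hence \<open>wt h = w\<close>; that \<open>h\<close> does not
        vanish there says that \<open>g\<close> and \<open>g1\<close> differ in the leading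
        coefficient.\<close>
      have "h \<noteq> (0, 0)" using h(1) H(2) by auto
      then have "mcoeff h (wt h) \<noteq> 0" by (rule mcoeff_wt)
      then have "wt h = w" using zero[of "wt h"] True h(2) by (auto simp: le_less)
      then have "mcoeff g w \<noteq> c" using hw \<open>mcoeff h (wt h) \<noteq> 0\<close> by auto
      then have "lead g \<noteq> lead g1" using True by (simp add: lead_def c_def w_def)
      moreover have "l = lead g"
        using h(3) \<open>wt h = w\<close> hw True by (simp add: \<phi>_def lead_def)
      ultimately show ?thesis using g by auto
    qed
  qed
  have "lead ` H = A \<union> B" "A \<inter> B = {}" by (auto simp: A_def B_def)
  then have "complexity H = image_mset fst (mset_set A) + image_mset fst (mset_set B)"
    using mset_set_Union[OF fin] by (simp add: complexity_def)
  also have "image_mset fst (mset_set A) = image_mset fst (mset_set (\<phi> ` A))"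
    using \<open>inj \<phi>\<close> by (simp add: image_mset_mset_set[symmetric] inj_on_subset multiset.map_comp)
       (simp add: \<phi>_def comp_def)
  finally have cH: "complexity H =
      image_mset fst (mset_set (\<phi> ` A)) + image_mset fst (mset_set B)" .
  have "mset_set (\<phi> ` A \<union> (lead ` F - \<phi> ` A)) = mset_set (\<phi> ` A) + mset_set (lead ` F - \<phi> ` A)"
    using fin F(1) by (intro mset_set_Union) auto
  moreover have "\<phi> ` A \<union> (lead ` F - \<phi> ` A) = lead ` F" using sub by auto
  ultimately have "mset_set (lead ` F) = mset_set (\<phi> ` A) + mset_set (lead ` F - \<phi> ` A)"
    by simp
  then have cF: "complexity F =
      image_mset fst (mset_set (\<phi> ` A)) + image_mset fst (mset_set (lead ` F - \<phi> ` A))"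
    by (simp add: complexity_def)
  \<comment> \<open>The term \<open>lead g1\<close> is left unmatched, and its weight
    \<open>w\<close> dominates all weights in \<open>B\<close>.\<close>
  have mem: "lead g1 \<in> lead ` F - \<phi> ` A" using sub g1 by auto
  have "lead g1 \<in># mset_set (lead ` F - \<phi> ` A)" using mem F(1) by simp
  moreover have "w = fst (lead g1)" by (simp add: lead_def w_def)
  ultimately have "w \<in># image_mset fst (mset_set (lead ` F - \<phi> ` A))"
    unfolding set_image_mset by blast
  moreover have "x < w" if "x \<in># image_mset fst (mset_set B)" for x
    using that fin(2) by (auto simp: B_def not_le)
  ultimately have "\<exists>j\<in>#image_mset fst (mset_set (lead ` F - \<phi> ` A)). (x, j) \<in> {(x, y). x < y}"
    if "x \<in># image_mset fst (mset_set B)" for x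
    using that by blast
  moreover have "image_mset fst (mset_set (lead ` F - \<phi> ` A)) \<noteq> {#}"
    using mem F(1) by (auto simp: mset_set_empty_iff)
  ultimately show ?thesis unfolding cH cF
    by (intro one_step_implies_mult) blast+
qed

section \<open>Colour focusing\<close>

text \<open>
  The finite sets W and E are uniform in the colouring c and the base point b; the induction needs
  this compactness because the next family depends on the possible positions and parameters.
\<close>

definition returns ::
    "poly_move set \<Rightarrow> nat set \<Rightarrow> (int \<times> int \<Rightarrow> int \<times> int) set \<Rightarrow> int set \<Rightarrow> bool" where
  "returns F K W E \<longleftrightarrow> finite W \<and> (\<forall>w\<in>W. unip w) \<and> finite E \<and> (\<forall>e\<in>E. 0 < e) \<and>
     (\<forall>c b. range c \<subseteq> K \<longrightarrow> (\<exists>w\<in>W. \<exists>e\<in>E. \<forall>g\<in>F. c (move g e (w b)) = c (w b)))"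

definition recurrent :: "poly_move set \<Rightarrow> bool" where
  "recurrent F \<longleftrightarrow> (\<forall>K. finite K \<longrightarrow> (\<exists>W E. returns F K W E))"

text \<open>Recurrence for \<open>H\<close> gives \<open>v\<close> and \<open>e\<close> such that
  the colours near \<open>move h e (v b)\<close> repeat those near \<open>v b\<close>. With the
  focus moved back by \<open>g1\<close> at \<open>e\<close>, parameter \<open>e + t\<close> from the
  new focus sees the colour that \<open>t\<close> saw from the old one.\<close>

lemma recurrent_step:
  assumes F: "F \<noteq> {}" "finite F" "\<And>g. g \<in> F \<Longrightarrow> null g"
    and twist: "\<And>A T. finite A \<Longrightarrow> (\<And>a. a \<in> A \<Longrightarrow> unip a) \<Longrightarrow> finite T \<Longrightarrow>
      \<exists>H. recurrent H \<and> (\<forall>a\<in>A. \<forall>t\<in>T. \<forall>g\<in>F. \<exists>h\<in>H. \<forall>e z.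
        move g t (a (move h e z)) = move g (e + t) (move_inv g1 e (a z)))"
  shows "recurrent F"
  unfolding recurrent_def
proof (intro allI impI)
  fix K :: "nat set" assume K: "finite K"
  define success where "success c W E b \<longleftrightarrow>
      (\<exists>w\<in>W. \<exists>e\<in>E. \<forall>g\<in>F. c (move g e (w b)) = c (w b))"
    for c :: "int \<times> int \<Rightarrow> nat" and W :: "(int \<times> int \<Rightarrow> int \<times> int) set" and E b
  define focused where "focused c a E S b \<longleftrightarrow> finite S \<and> c (a b) \<notin> S \<and>
      (\<forall>k\<in>S. \<exists>e\<in>E. \<forall>g\<in>F. c (move g e (a b)) = k)"
    for c :: "int \<times> int \<Rightarrow> nat" and a :: "int \<times> int \<Rightarrow> int \<times> int" and E S b
  \<comment> \<open>S collects the colours of monochromatic sets focused at a b, so it has at most card K elements\<close>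
  define Q where "Q n W E \<longleftrightarrow> finite W \<and> (\<forall>w\<in>W. unip w) \<and> finite E \<and> (\<forall>e\<in>E. 0 < e) \<and>
      (\<forall>c. range c \<subseteq> K \<longrightarrow>
        (\<forall>b. success c W E b \<or> (\<exists>a\<in>W. \<exists>S. card S = n \<and> focused c a E S b)))" for n W E
  have "\<exists>W E. Q n W E" for n
  proof (induction n)
    case 0
    have "Q 0 {id} {}" by (auto simp: Q_def unip_id focused_def)
    then show ?case by blast
  next
    case (Suc n)
    then obtain W E where Q: "Q n W E" by blast
    then have W: "finite W" "\<And>w. w \<in> W \<Longrightarrow> unip w" and E: "finite E" "\<And>e. e \<in> E \<Longrightarrow> 0 < e"
      by (auto simp: Q_def)
    \<comment> \<open>Parameter 0 is included because moves are the identity there: it adds the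
      colour of the old focus to the collection.\<close>
    obtain H where H: "recurrent H" and twist:
      "\<forall>a\<in>W. \<forall>t\<in>insert 0 E. \<forall>g\<in>F. \<exists>h\<in>H. \<forall>e z.
        move g t (a (move h e z)) = move g (e + t) (move_inv g1 e (a z))"
      using twist[OF W, of "insert 0 E"] E(1) by auto
    \<comment> \<open>C z records the colours of all points near z that an n-focused configuration at z may use\<close>
    define U where "U = W \<union> (\<lambda>(g, t, w). move g t \<circ> w) ` (F \<times> E \<times> W)"
    have "finite U" using W E F by (auto simp: U_def)
    then obtain us where us: "set us = U" using finite_list by blast
    \<comment> \<open>Colour patterns are coded by \<open>to_nat\<close>, since
      \<open>recurrent\<close> is stated for colours in \<open>nat\<close>.\<close>
    define K' where "K' = to_nat ` {xs. set xs \<subseteq> K \<and> length xs = length us}"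
    have "finite K'" using K by (simp add: K'_def finite_lists_length_eq)
    with H obtain V D where "returns H K' V D" unfolding recurrent_def by blast
    then have V: "finite V" "\<And>v. v \<in> V \<Longrightarrow> unip v"
      and D: "finite D" "\<And>e. e \<in> D \<Longrightarrow> 0 < e"
      and rec: "\<And>c b. range c \<subseteq> K' \<Longrightarrow> \<exists>v\<in>V. \<exists>e\<in>D. \<forall>h\<in>H. c (move h e (v b)) = c (v b)"
      by (auto simp: returns_def)
    \<comment> \<open>The first part keeps the previous configurations, now based at
      \<open>v b\<close>; the second holds the new foci. In \<open>E'\<close>, the set
      \<open>D\<close> is the case t = 0.\<close>
    define W' where "W' = (\<lambda>(w, v). w \<circ> v) ` (W \<times> V) \<union>
        (\<lambda>(e, w, v). move_inv g1 e \<circ> (w \<circ> v)) ` (D \<times> W \<times> V)"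
    define E' where "E' = E \<union> D \<union> (\<lambda>(e, t). e + t) ` (D \<times> E)"
    have "finite W'" "\<forall>w\<in>W'. unip w" "finite E'" "\<forall>e\<in>E'. 0 < e"
      using W V E D by (auto simp: W'_def E'_def intro!: unip_comp unip_move_inv add_pos_pos)
    moreover have "success c W' E' b \<or> (\<exists>a\<in>W'. \<exists>S. card S = Suc n \<and> focused c a E' S b)"
      if c: "range c \<subseteq> K" for c b
    proof -
      define C where "C z = to_nat (map (\<lambda>u. c (u z)) us)" for z
      have "C z \<in> K'" for z unfolding C_def K'_def using c by (intro imageI) auto
      then have "range C \<subseteq> K'" by blast
      from rec[OF this, of b] obtain v e where v: "v \<in> V" and e: "e \<in> D"
        and "\<And>h. h \<in> H \<Longrightarrow> C (move h e (v b)) = C (v b)" by blast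
      then have shift: "c (u (move h e (v b))) = c (u (v b))" if "h \<in> H" "u \<in> U" for h u
        using that us by (auto simp: C_def)
      have "success c W E (v b) \<or> (\<exists>a\<in>W. \<exists>S. card S = n \<and> focused c a E S (v b))"
        using Q c unfolding Q_def by blast
      then show ?thesis
      proof
        assume "success c W E (v b)"
        then obtain w t where "w \<in> W" "t \<in> E" "\<forall>g\<in>F. c (move g t (w (v b))) = c (w (v b))"
          by (auto simp: success_def)
        moreover have "w \<circ> v \<in> W'" "t \<in> E'" using calculation v by (auto simp: W'_def E'_def)
        ultimately have "success c W' E' b"
          unfolding success_def by (intro bexI[of _ "w \<circ> v"] bexI[of _ t]) auto
        then show ?thesis ..
      next
        assume "\<exists>a\<in>W. \<exists>S. card S = n \<and> focused c a E S (v b)"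
        then obtain a S where a: "a \<in> W" and S: "card S = n" "finite S" "c (a (v b)) \<notin> S"
          and foc: "\<And>k. k \<in> S \<Longrightarrow> \<exists>t\<in>E. \<forall>g\<in>F. c (move g t (a (v b))) = k"
          by (auto simp: focused_def)
        define a' where "a' = move_inv g1 e \<circ> (a \<circ> v)"
        have a': "a' \<in> W'" unfolding a'_def W'_def
          using a v e by (intro UnI2 image_eqI[of _ _ "(e, a, v)"]) auto
        have new: "c (move g (e + t) (a' b)) = c (move g t (a (v b)))"
          if "g \<in> F" "t \<in> insert 0 E" for g t
        proof -
          from twist a that obtain h where h: "h \<in> H" and
            eq: "move g t (a (move h e (v b))) = move g (e + t) (move_inv g1 e (a (v b)))"
            by blast
          show ?thesis
          proof (cases "t = 0")
            case True
            then show ?thesis using shift[OF h, of a] a eq that F(3)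
              by (simp add: U_def a'_def move_0)
          next
            case False
            then have "move g t \<circ> a \<in> U" unfolding U_def
              using that a by (intro UnI2 image_eqI[of _ _ "(g, t, a)"]) auto
            from shift[OF h this] show ?thesis using eq by (simp add: a'_def)
          qed
        qed
        have foc': "\<exists>e\<in>E'. \<forall>g\<in>F. c (move g e (a' b)) = k" if "k \<in> insert (c (a (v b))) S" for k
        proof (cases "k = c (a (v b))")
          case True
          then have "\<forall>g\<in>F. c (move g e (a' b)) = k" using new[of _ 0] F(3) by (simp add: move_0)
          then show ?thesis using e by (auto simp: E'_def)
        next
          case False
          with that foc obtain t where t: "t \<in> E" "\<forall>g\<in>F. c (move g t (a (v b))) = k" by blast
          then have "\<forall>g\<in>F. c (move g (e + t) (a' b)) = k" using new by simp
          moreover have "e + t \<in> E'" using e t(1) by (auto simp: E'_def)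
          ultimately show ?thesis by blast
        qed
        \<comment> \<open>Either the new focus has one of the n + 1 collected colours, which is a
          success, or it avoids them all and remains focused.\<close>
        show ?thesis
        proof (cases "c (a' b) \<in> insert (c (a (v b))) S")
          case True
          from foc'[OF this] a' have "success c W' E' b" by (auto simp: success_def)
          then show ?thesis ..
        next
          case False
          then have "focused c a' E' (insert (c (a (v b))) S) b"
            using foc' S(2) by (simp add: focused_def)
          moreover have "card (insert (c (a (v b))) S) = Suc n" using S by simp
          ultimately show ?thesis using a' by blast
        qed
      qed
    qed
    ultimately have "Q (Suc n) W' E'" by (auto simp: Q_def)
    then show ?case by blast
  qed
  then obtain W E where Q: "Q (card K) W E" by blast
  have "success c W E b" if c: "range c \<subseteq> K" for c b
  proof (rule ccontr)
    assume "\<not> success c W E b"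
    then obtain a S where S: "card S = card K" "focused c a E S b"
      using Q c unfolding Q_def by blast
    \<comment> \<open>As \<open>F\<close> is nonempty, every element of \<open>S\<close> is the
      colour of some point, and the focus has yet another colour: \<open>K\<close> is too small for
      this.\<close>
    then have "S \<subseteq> K - {c (a b)}" using F(1) c by (fastforce simp: focused_def)
    then have "S \<subset> K" using c by auto
    then show False using S(1) K psubset_card_mono by (metis less_irrefl)
  qed
  then have "returns F K W E" using Q unfolding Q_def returns_def success_def by blast
  then show "\<exists>W E. returns F K W E" by blast
qed

section \<open>Well-founded induction on the complexity\<close>

lemma recurrent_remove_zero:
  assumes "recurrent (F - {(0, 0)})"
  shows "recurrent F"
proof -
  have "c (move g e z) = c z" if "\<forall>g\<in>F - {(0, 0)}. c (move g e z) = c z" "g \<in> F"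
    for c :: "int \<times> int \<Rightarrow> nat" and g e z
    using that by (cases "g = (0, 0)"; cases z) auto
  then have eq: "(\<forall>g\<in>F - {(0, 0)}. c (move g e z) = c z) \<longleftrightarrow> (\<forall>g\<in>F. c (move g e z) = c z)"
    for c :: "int \<times> int \<Rightarrow> nat" and e z by blast
  show ?thesis using assms unfolding recurrent_def returns_def eq .
qed

text \<open>The twisted moves of \<open>F\<close> relative to some \<open>g1\<close> of least weight
  have smaller complexity, hence are recurrent by induction, and \<open>recurrent_step\<close>
  brings this back to \<open>F\<close>.\<close>

lemma recurrent_nonzero:
  assumes "finite F" "\<forall>g\<in>F. null g \<and> g \<noteq> (0, 0)"
  shows "recurrent F"
proof -
  have "wf (inv_image (mult {(x, y). x < y}) complexity)"
    by (intro wf_inv_image wf_mult wf)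
  then show ?thesis using assms
  proof (induction F rule: wf_induct_rule)
    case (less F)
    show ?case
    proof (cases "F = {}")
      case True
      then have "returns F K {id} {1}" for K by (simp add: returns_def unip_id)
      then show ?thesis unfolding recurrent_def by blast
    next
      case False
      define g1 where "g1 = arg_min_on wt F"
      have g1: "g1 \<in> F" "\<And>g. g \<in> F \<Longrightarrow> wt g1 \<le> wt g"
        using False less.prems(1) unfolding g1_def
        by (auto intro: arg_min_if_finite(1) arg_min_least)
      show ?thesis
      proof (rule recurrent_step[where ?g1.0 = g1])
        fix A and T :: "int set"
        assume A: "finite A" "\<And>a. a \<in> A \<Longrightarrow> unip a" and T: "finite T"
        define good where "good a t g h \<longleftrightarrow> null h \<and>
            (\<forall>e z. move g t (a (move h e z)) = move g (e + t) (move_inv g1 e (a z))) \<and>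
            (\<forall>i\<ge>wt g. mcoeff h i = mcoeff g i - mcoeff g1 i)" for a t g h
        define h where "h a t g = (SOME h. good a t g h)" for a t g
        have h: "good a t g (h a t g)" if "a \<in> A" "g \<in> F" for a t g
        proof -
          have "unip a" "null g" "g \<noteq> (0, 0)" "null g1" "wt g1 \<le> wt g"
            using that A(2) less.prems(2) g1 by auto
          then obtain h' where "null h'"
            "\<And>e z. move g t (a (move h' e z)) = move g (e + t) (move_inv g1 e (a z))"
            "\<And>i. wt g \<le> i \<Longrightarrow> mcoeff h' i = mcoeff g i - mcoeff g1 i"
            by (rule twisted_move[where t = t]) (rule that)
          then have "good a t g h'" by (simp add: good_def)
          then show ?thesis unfolding h_def by (rule someI)
        qed
        define H where "H = (\<lambda>(a, t, g). h a t g) ` (A \<times> T \<times> F)"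
        have fin: "finite H" using A T less.prems by (simp add: H_def)
        have top: "null x \<and> (\<exists>g\<in>F. \<forall>i\<ge>wt g. mcoeff x i = mcoeff g i - mcoeff g1 i)"
          if "x \<in> H" for x
        proof -
          from that obtain a t g where "a \<in> A" "g \<in> F" "x = h a t g"
            unfolding H_def by force
          then show ?thesis using h[of a g t] unfolding good_def by blast
        qed
        \<comment> \<open>The identity \<open>(0, 0)\<close> has no leading term; it is set aside
          here and restored by \<open>recurrent_remove_zero\<close>.\<close>
        have "(complexity (H - {(0, 0)}), complexity F) \<in> mult {(x, y). x < y}"
          using less.prems g1 fin top by (intro complexity_decreases[of F g1]) blast+
        then have "recurrent (H - {(0, 0)})"
          using fin top by (intro less.IH) (simp_all add: inv_image_def)
        then have "recurrent H" by (rule recurrent_remove_zero)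
        moreover have "\<forall>a\<in>A. \<forall>t\<in>T. \<forall>g\<in>F. \<exists>h\<in>H. \<forall>e z.
            move g t (a (move h e z)) = move g (e + t) (move_inv g1 e (a z))"
        proof (intro ballI)
          fix a t g assume "a \<in> A" "t \<in> T" "g \<in> F"
          moreover from this have "h a t g \<in> H" unfolding H_def by force
          ultimately show "\<exists>h\<in>H. \<forall>e z.
              move g t (a (move h e z)) = move g (e + t) (move_inv g1 e (a z))"
            using h[of a g t] unfolding good_def by blast
        qed
        ultimately show "\<exists>H. recurrent H \<and> (\<forall>a\<in>A. \<forall>t\<in>T. \<forall>g\<in>F. \<exists>h\<in>H. \<forall>e z.
            move g t (a (move h e z)) = move g (e + t) (move_inv g1 e (a z)))" by blast
      qed (use False less.prems in auto)
    qed
  qed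
qed

theorem polynomial_move_recurrence:
  fixes c :: "int \<times> int \<Rightarrow> 'k"
  assumes "finite F" "\<And>g. g \<in> F \<Longrightarrow> null g" "finite (range c)"
  obtains x d e where "0 < e" "\<And>g. g \<in> F \<Longrightarrow> c (move g e (x, d)) = c (x, d)"
proof -
  obtain f :: "'k \<Rightarrow> nat" where f: "inj_on f (range c)"
    using finite_imp_inj_to_nat_seg[OF assms(3)] by blast
  have "recurrent (F - {(0, 0)})"
    using assms by (intro recurrent_nonzero) auto
  then have "recurrent F" by (rule recurrent_remove_zero)
  moreover have "finite (range (f \<circ> c))" unfolding image_comp[symmetric] using assms(3) by (rule finite_imageI)
  ultimately obtain W E where "returns F (range (f \<circ> c)) W E"
    unfolding recurrent_def by blast
  then have E: "\<And>e. e \<in> E \<Longrightarrow> 0 < e" and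
    rec: "\<And>c' b. range c' \<subseteq> range (f \<circ> c) \<Longrightarrow>
        \<exists>w\<in>W. \<exists>e\<in>E. \<forall>g\<in>F. c' (move g e (w b)) = c' (w b)"
    unfolding returns_def by blast+
  from rec[of "f \<circ> c" "(0, 0)", OF subset_refl]
  obtain w :: "int \<times> int \<Rightarrow> int \<times> int" and e where "e \<in> E"
    "\<forall>g\<in>F. (f \<circ> c) (move g e (w (0, 0))) = (f \<circ> c) (w (0, 0))" by blast
  moreover obtain x d where "w (0, 0) = (x, d)" by (cases "w (0, 0)")
  ultimately have "\<forall>g\<in>F. f (c (move g e (x, d))) = f (c (x, d))" unfolding o_apply by metis
  then have "\<forall>g\<in>F. c (move g e (x, d)) = c (x, d)" using inj_onD[OF f] by blast
  with E[OF \<open>e \<in> E\<close>] that[of e x d] show ?thesis by blast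
qed

section \<open>Shifts that preserve colours\<close>

definition linked ::
    "(int \<Rightarrow> 'c) \<Rightarrow> int poly \<Rightarrow> int poly \<Rightarrow> poly_move set \<Rightarrow> int \<Rightarrow> int \<Rightarrow> int \<Rightarrow> bool" where
  "linked \<chi> p r F x d e \<longleftrightarrow>
     (\<forall>g\<in>F. case move g e (x, d) of (y, d') \<Rightarrow> \<chi> (y + poly p d') = \<chi> (y + poly r d'))"

text \<open>\<open>F\<close> serves all x, d and e at once, because it must be fixed before
  recurrence supplies them.\<close>

definition controls ::
    "(int \<Rightarrow> 'c) \<Rightarrow> int poly \<Rightarrow> int poly \<Rightarrow> int poly poly \<Rightarrow> int poly poly \<Rightarrow> poly_move set \<Rightarrow> bool" where
  "controls \<chi> p r V U F \<longleftrightarrow> finite F \<and> (\<forall>g\<in>F. null g) \<and>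
     (\<forall>x d e. linked \<chi> p r F x d e \<longrightarrow>
        \<chi> (x + poly p d + ev V d e + ev U d e) = \<chi> (x + poly p d + ev V d e))"

text \<open>The arbitrary offset \<open>V\<close> lets invariant shifts be chained, which gives
  closure under differences.\<close>

definition shift_invariant :: "(int \<Rightarrow> 'c) \<Rightarrow> int poly \<Rightarrow> int poly \<Rightarrow> int poly poly \<Rightarrow> bool" where
  "shift_invariant \<chi> p r U \<longleftrightarrow> (\<forall>d. ev U d 0 = 0) \<and>
     (\<forall>V. (\<forall>d. ev V d 0 = 0) \<longrightarrow> (\<exists>F. controls \<chi> p r V U F))"

lemma linked_subset: "linked \<chi> p r F x d e \<Longrightarrow> G \<subseteq> F \<Longrightarrow> linked \<chi> p r G x d e"
  unfolding linked_def by (rule ballI, drule (1) subsetD, erule (1) bspec)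

lemma linked_Un: "linked \<chi> p r (F \<union> G) x d e \<longleftrightarrow> linked \<chi> p r F x d e \<and> linked \<chi> p r G x d e"
  by (simp only: linked_def ball_Un)

lemma shift_invariant_diff:
  assumes "shift_invariant \<chi> p r U" "shift_invariant \<chi> p r U'"
  shows "shift_invariant \<chi> p r (U - U')"
  unfolding shift_invariant_def
proof (intro conjI allI impI)
  show "ev (U - U') d 0 = 0" for d using assms by (simp add: shift_invariant_def)
next
  fix V :: "int poly poly" assume V: "\<forall>d. ev V d 0 = 0"
  then have V': "\<forall>d. ev (V - U') d 0 = 0" using assms by (simp add: shift_invariant_def)
  \<comment> \<open>From the common offset \<open>V - U'\<close>, the shift \<open>U'\<close> leads
    to \<open>V\<close> and the shift \<open>U\<close> to \<open>V + U - U'\<close>.\<close>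
  obtain F G where F: "controls \<chi> p r (V - U') U F" and G: "controls \<chi> p r (V - U') U' G"
    using assms V' unfolding shift_invariant_def by blast
  have "\<chi> (x + poly p d + ev V d e + ev (U - U') d e) = \<chi> (x + poly p d + ev V d e)"
    if "linked \<chi> p r (F \<union> G) x d e" for x d e
  proof -
    have "\<chi> (x + poly p d + ev (V - U') d e + ev U d e) = \<chi> (x + poly p d + ev (V - U') d e)"
      using F that unfolding controls_def linked_Un by blast
    also have "\<dots> = \<chi> (x + poly p d + ev (V - U') d e + ev U' d e)"
      using G that unfolding controls_def linked_Un by metis
    finally show ?thesis by (simp add: algebra_simps)
  qed
  then have "controls \<chi> p r V (U - U') (F \<union> G)"
    using F G unfolding controls_def by blast
  then show "\<exists>F. controls \<chi> p r V (U - U') F" ..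
qed

lemma shift_invariant_increment:
  assumes s: "poly s 0 = 0" "poly t 0 = 0"
  shows "shift_invariant \<chi> p r
    (pcompose (lift (p - r)) [:s, 1:] - pcompose (lift (p - r)) [:t, 1:])" (is "shift_invariant _ _ _ ?U")
  unfolding shift_invariant_def
proof (intro conjI allI impI)
  show "ev ?U d 0 = 0" for d using s by simp
next
  fix V :: "int poly poly" assume V: "\<forall>d. ev V d 0 = 0"
  \<comment> \<open>Let Q = p - r and A = x + p(d) + V. \<open>G1\<close> puts the p-point at A and
    the r-point at A - Q(d + t); \<open>G2\<close> puts the r-point at A - Q(d + t) and the p-point
    at A + \<open>?U\<close>. The two links join A to A + \<open>?U\<close>.\<close>
  define G1 where "G1 = V + lift p - pcompose (lift p) [:t, 1:]"
  define G2 where "G2 = V + lift p - pcompose (lift (p - r)) [:t, 1:] - pcompose (lift r) [:s, 1:]"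
  have "null (t, G1)" "null (s, G2)" using s V by (simp_all add: G1_def G2_def)
  moreover have "\<chi> (x + poly p d + ev V d e + ev ?U d e) = \<chi> (x + poly p d + ev V d e)"
    if "linked \<chi> p r {(t, G1), (s, G2)} x d e" for x d e
    using that by (simp add: linked_def G1_def G2_def algebra_simps)
  ultimately have "controls \<chi> p r V ?U {(t, G1), (s, G2)}" unfolding controls_def by blast
  then show "\<exists>F. controls \<chi> p r V ?U F" ..
qed

section \<open>Iterated differences of polynomials\<close>

lemma coeff_pcompose_linear_subleading:
  fixes p :: "'a::idom poly"
  assumes "degree p \<le> Suc m"
  shows "coeff (pcompose p [:c, 1:]) m = coeff p m + of_nat (Suc m) * c * coeff p (Suc m)"
  using assms
proof (induction p arbitrary: m)
  case 0
  then show ?case by simp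
next
  case (pCons a p)
  have deg: "degree p \<le> m" using pCons.prems pCons.hyps by (auto split: if_splits)
  show ?case
  proof (cases m)
    case 0
    then show ?thesis using coeff_pcompose_monic_linear[of p 0 c] deg
      by (simp add: pcompose_pCons)
  next
    case (Suc k)
    then show ?thesis using pCons.IH[of k] deg coeff_pcompose_monic_linear[of p "Suc k" c]
      by (simp add: pcompose_pCons coeff_pCons algebra_simps)
  qed
qed

lemma difference_poly:
  fixes p :: "'a::{idom,ring_char_0} poly"
  assumes "degree p = Suc m" "c \<noteq> 0"
  defines "D \<equiv> pcompose p [:c, 1:] - p"
  shows "degree D = m" "lead_coeff D = of_nat (Suc m) * c * lead_coeff p"
proof -
  have m: "coeff D m = of_nat (Suc m) * c * lead_coeff p"
    using coeff_pcompose_linear_subleading[of p m c] assms by simp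
  have "lead_coeff p \<noteq> 0"
    using assms(1) by (metis degree_0 leading_coeff_0_iff nat.distinct(1))
  then have "coeff D m \<noteq> 0" using assms(2) unfolding m by (simp del: of_nat_Suc)
  then have "m \<le> degree D" by (rule le_degree)
  moreover have "degree D \<le> m"
    using coeff_pcompose_monic_linear[of p _ c] assms(1) by (intro degree_le) (auto simp: D_def)
  ultimately show "degree D = m" by simp
  then show "lead_coeff D = of_nat (Suc m) * c * lead_coeff p" using m by simp
qed

text \<open>Passing to Q(d + e) - Q(d), with e the inner variable, lowers the degree by one and
  multiplies the leading coefficient by the old degree and by e. In degree 1 the increments for
  \<open>h\<close> and 0 differ by the leading coefficient times \<open>h\<close>.\<close>

lemma iterated_difference_mem:
  fixes Q :: "int poly poly" and R :: "int poly poly set"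
  assumes diff: "\<And>U V. U \<in> R \<Longrightarrow> V \<in> R \<Longrightarrow> U - V \<in> R"
    and "degree Q = Suc n" and h: "poly h 0 = 0"
    and "\<And>s t. poly s 0 = 0 \<Longrightarrow> poly t 0 = 0 \<Longrightarrow> pcompose Q [:s, 1:] - pcompose Q [:t, 1:] \<in> R"
  shows "[: fact (Suc n) * lead_coeff Q * [:0, 1:] ^ n * h :] \<in> R"
  using assms(2,4)
proof (induction n arbitrary: Q)
  case 0
  then obtain a b where Q: "Q = [:b, a:]"
    by (metis degree_eq_zeroE degree_pCons_eq_if nat.inject old.nat.distinct(2) pCons_cases)
  have "pcompose Q [:h, 1:] - pcompose Q [:0, 1:] \<in> R" by (rule 0(2)) (simp_all add: h)
  moreover have "pcompose Q [:h, 1:] - pcompose Q [:0, 1:] = [:a * h:]"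
    by (simp add: Q pcompose_pCons algebra_simps)
  moreover have "lead_coeff Q = a" using 0(1) by (simp add: Q)
  ultimately show ?case by simp
next
  case (Suc n)
  define D where "D = pcompose Q [:[:0, 1:], 1:] - Q"
  have D: "degree D = Suc n" "lead_coeff D = of_nat (Suc (Suc n)) * [:0, 1:] * lead_coeff Q"
    unfolding D_def using difference_poly[OF Suc.prems(1), of "[:0, 1:]"] by simp_all
  have comp: "pcompose D [:s, 1:] = pcompose Q [:[:0, 1:] + s, 1:] - pcompose Q [:s, 1:]" for s
    by (simp add: D_def pcompose_diff pcompose_assoc[symmetric] pcompose_pCons)
  \<comment> \<open>An increment of \<open>D\<close> is a difference of two increments of
    \<open>Q\<close>, and e + s, e + t still vanish at e = 0.\<close>
  have "pcompose D [:s, 1:] - pcompose D [:t, 1:] \<in> R" if "poly s 0 = 0" "poly t 0 = 0" for s t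
  proof -
    have "(pcompose Q [:[:0, 1:] + s, 1:] - pcompose Q [:[:0, 1:] + t, 1:])
        - (pcompose Q [:s, 1:] - pcompose Q [:t, 1:]) \<in> R"
      using that by (intro diff Suc.prems(2)) auto
    then show ?thesis by (simp add: comp algebra_simps)
  qed
  with D(1) have "[: fact (Suc n) * lead_coeff D * [:0, 1:] ^ n * h :] \<in> R"
    by (rule Suc.IH)
  moreover have "fact (Suc n) * lead_coeff D * [:0, 1:] ^ n * h
      = fact (Suc (Suc n)) * lead_coeff Q * [:0, 1:] ^ Suc n * h"
    unfolding D(2) fact_Suc[of "Suc n"] power_Suc by (simp only: ac_simps)
  ultimately show ?case by simp
qed

section \<open>From coincidences to monochromatic and rainbow patterns\<close>

lemma monochromatic_if_linked:
  fixes \<chi> :: "int \<Rightarrow> 'c"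
  assumes pr: "p \<noteq> r" "poly p 0 = 0" "poly r 0 = 0" and ps: "\<And>q. q \<in> set ps \<Longrightarrow> poly q 0 = 0"
  obtains F where "finite F" "\<And>g. g \<in> F \<Longrightarrow> null g"
    "\<And>x d e. 0 < e \<Longrightarrow> linked \<chi> p r F x d e \<Longrightarrow>
      \<exists>a b. b \<noteq> 0 \<and> monochromatic \<chi> (poly_pattern ps a b)"
proof -
  define Q where "Q = lift (p - r)"
  have coeff_Q: "coeff Q n = [:coeff (p - r) n:]" for n
    unfolding Q_def lift_def by (simp add: coeff_map_poly)
  have "degree (p - r) \<noteq> 0"
  proof
    assume "degree (p - r) = 0"
    then obtain a where "p - r = [:a:]" by (rule degree_eq_zeroE)
    moreover have "poly (p - r) 0 = 0" using pr by simp
    ultimately show False using pr(1) by simp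
  qed
  then obtain n where n: "degree (p - r) = Suc n" by (cases "degree (p - r)") auto
  have "degree Q = degree (p - r)"
    unfolding Q_def lift_def by (rule degree_map_poly) simp
  then have deg: "degree Q = Suc n" by (simp add: n)
  define l where "l = lead_coeff (p - r)"
  have l: "l \<noteq> 0" using pr(1) unfolding l_def leading_coeff_0_iff by simp
  have lead: "lead_coeff Q = [:l:]" by (simp add: deg coeff_Q l_def n)
  \<comment> \<open>The factor produced by the iterated differences, times one more e;
    \<open>b\<close> at e is the d of the monochromatic pattern.\<close>
  define b where "b = fact (Suc n) * [:l:] * [:0, 1:] ^ Suc n"
  have b: "poly b e \<noteq> 0" if "0 < e" for e
  proof -
    have "poly (fact (Suc n)) e = fact (Suc n)"
      unfolding of_nat_fact[symmetric, where ?'a = "int poly"] of_nat_poly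
      by (simp del: fact_Suc)
    then have "poly b e = fact (Suc n) * l * e ^ Suc n"
      unfolding b_def poly_mult poly_power by (simp del: fact_Suc)
    then show ?thesis using l that by (simp del: fact_Suc)
  qed
  define good where "good q F \<longleftrightarrow> finite F \<and> (\<forall>g\<in>F. null g) \<and>
      (\<forall>x d e. linked \<chi> p r F x d e \<longrightarrow> \<chi> (x + poly p d + poly q (poly b e)) = \<chi> (x + poly p d))"
    for q F
  have "\<exists>F. good q F" if "q \<in> set ps" for q
  proof -
    obtain c q' where q: "q = pCons c q'" by (cases q)
    then have c: "c = 0" using ps[OF that] by simp
    \<comment> \<open>As q(0) = 0, q(b) = b q'(b). The factor e in \<open>h\<close> completes e^n to
      the e^(n + 1) in \<open>b\<close>, so the invariant shift is exactly q(b).\<close>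
    define h where "h = [:0, 1:] * pcompose q' b"
    have "poly h 0 = 0" by (simp add: h_def)
    then have "[: fact (Suc n) * lead_coeff Q * [:0, 1:] ^ n * h :] \<in> Collect (shift_invariant \<chi> p r)"
      using deg by (intro iterated_difference_mem)
        (auto simp: Q_def intro: shift_invariant_diff shift_invariant_increment)
    moreover have "fact (Suc n) * lead_coeff Q * [:0, 1:] ^ n * h = pcompose q b"
      unfolding lead q c h_def pcompose_pCons b_def power_Suc by (simp add: ac_simps)
    ultimately have "shift_invariant \<chi> p r [:pcompose q b:]" by simp
    \<comment> \<open>With offset 0 every shift starts from x + p(d), the first entry of the
      pattern.\<close>
    moreover have "\<forall>d. ev 0 d 0 = 0" by simp
    ultimately obtain F where "controls \<chi> p r 0 [:pcompose q b:] F"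
      unfolding shift_invariant_def by blast
    then have "good q F" by (simp add: good_def controls_def poly_pcompose)
    then show ?thesis ..
  qed
  then have "\<forall>q\<in>set ps. \<exists>F. good q F" by blast
  from bchoice[OF this] obtain F where "\<forall>q\<in>set ps. good q (F q)" by blast
  then have F: "\<And>q. q \<in> set ps \<Longrightarrow> finite (F q)"
    "\<And>q g. q \<in> set ps \<Longrightarrow> g \<in> F q \<Longrightarrow> null g"
    "\<And>q x d e. q \<in> set ps \<Longrightarrow> linked \<chi> p r (F q) x d e \<Longrightarrow>
      \<chi> (x + poly p d + poly q (poly b e)) = \<chi> (x + poly p d)"
    unfolding good_def by blast+
  show thesis
  proof (rule that[of "\<Union>q\<in>set ps. F q"])
    fix x d e assume "0 < e" and link: "linked \<chi> p r (\<Union>q\<in>set ps. F q) x d e"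
    have "\<chi> (x + poly p d + poly q (poly b e)) = \<chi> (x + poly p d)" if "q \<in> set ps" for q
    proof (rule F(3)[OF that])
      have "F q \<subseteq> (\<Union>q\<in>set ps. F q)" using that by blast
      with link show "linked \<chi> p r (F q) x d e" by (rule linked_subset)
    qed
    then have "monochromatic \<chi> (poly_pattern ps (x + poly p d) (poly b e))"
      by (auto simp: monochromatic_def poly_pattern_def)
    with b[OF \<open>0 < e\<close>] show "\<exists>a b. b \<noteq> 0 \<and> monochromatic \<chi> (poly_pattern ps a b)" by blast
  next
    show "finite (\<Union>q\<in>set ps. F q)" using F(1) by simp
    show "null g" if "g \<in> (\<Union>q\<in>set ps. F q)" for g using that F(2) by blast
  qed
qed

text \<open>The clause on \<open>d\<close> excludes the trivial solution d = 0. If 0 is in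
  \<open>ps\<close>, no pattern is rainbow and an injective \<chi> may leave only d = 0.\<close>

theorem theorem3:
  fixes ps :: "int poly list" and \<chi> :: "int \<Rightarrow> 'c"
  assumes "distinct ps"
    and "\<And>p. p \<in> set ps \<Longrightarrow> poly p 0 = 0"
  shows "\<exists>a d :: int. (0 \<notin> set ps \<longrightarrow> d \<noteq> 0) \<and>
           (monochromatic \<chi> (poly_pattern ps a d) \<or> rainbow \<chi> (poly_pattern ps a d))"
proof (cases "0 \<in> set ps \<or> ps = []")
  case True
  then show ?thesis
  proof
    assume "0 \<in> set ps"
    moreover have "monochromatic \<chi> (poly_pattern ps 0 0)"
      using assms(2) by (auto simp: monochromatic_def poly_pattern_def)
    ultimately show ?thesis by blast
  next
    assume "ps = []"
    then have "monochromatic \<chi> (poly_pattern ps 0 1)"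
      by (simp add: monochromatic_def poly_pattern_def)
    then show ?thesis by (intro exI[of _ 0] exI[of _ 1]) simp
  qed
next
  case False
  \<comment> \<open>The polynomial 0 stands for the entry a itself.\<close>
  define P where "P = set (0 # ps)"
  define T where "T = {(p, r). p \<in> P \<and> r \<in> P \<and> p \<noteq> r}"
  have "finite T" by (rule finite_subset[of _ "P \<times> P"]) (auto simp: T_def P_def)
  have P0: "poly p 0 = 0" if "p \<in> P" for p using that assms(2) by (auto simp: P_def)
  define good where "good z F \<longleftrightarrow> finite F \<and> (\<forall>g\<in>F. null g) \<and>
      (\<forall>x d e. 0 < e \<longrightarrow> linked \<chi> (fst z) (snd z) F x d e \<longrightarrow>
        (\<exists>a b. b \<noteq> 0 \<and> monochromatic \<chi> (poly_pattern ps a b)))" for z F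
  have "\<exists>F. good z F" if "z \<in> T" for z
  proof -
    have z: "fst z \<noteq> snd z" "poly (fst z) 0 = 0" "poly (snd z) 0 = 0"
      using that P0 by (auto simp: T_def)
    obtain F where "finite F" "\<And>g. g \<in> F \<Longrightarrow> null g"
      "\<And>x d e. 0 < e \<Longrightarrow> linked \<chi> (fst z) (snd z) F x d e \<Longrightarrow>
        \<exists>a b. b \<noteq> 0 \<and> monochromatic \<chi> (poly_pattern ps a b)"
      by (rule monochromatic_if_linked[where \<chi> = \<chi>, OF z assms(2)]) (assumption, rule that)
    then have "good z F" unfolding good_def by blast
    then show ?thesis ..
  qed
  then have "\<forall>z\<in>T. \<exists>F. good z F" by blast
  from bchoice[OF this] obtain F where "\<forall>z\<in>T. good z (F z)" by blast
  then have F: "\<And>z. z \<in> T \<Longrightarrow> finite (F z)" "\<And>z g. z \<in> T \<Longrightarrow> g \<in> F z \<Longrightarrow> null g"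
    "\<And>z x d e. z \<in> T \<Longrightarrow> 0 < e \<Longrightarrow> linked \<chi> (fst z) (snd z) (F z) x d e \<Longrightarrow>
       \<exists>a b. b \<noteq> 0 \<and> monochromatic \<chi> (poly_pattern ps a b)"
    unfolding good_def by blast+
  \<comment> \<open>A colouring with finitely many values, even if \<chi> uses infinitely many
    colours.\<close>
  define coincide where "coincide y =
      {z \<in> T. \<chi> (fst y + poly (fst z) (snd y)) = \<chi> (fst y + poly (snd z) (snd y))}" for y
  have "range coincide \<subseteq> Pow T" unfolding coincide_def by blast
  then have fin: "finite (range coincide)" by (rule finite_subset) (simp add: \<open>finite T\<close>)
  \<comment> \<open>The moves for all pairs are taken together, since it is not known in advance
    which pair will coincide.\<close>
  have fin': "finite (\<Union>z\<in>T. F z)" using F(1) \<open>finite T\<close> by simp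
  have null: "null g" if "g \<in> (\<Union>z\<in>T. F z)" for g using that F(2) by blast
  obtain x d e where "0 < e" and const:
    "\<And>g. g \<in> (\<Union>z\<in>T. F z) \<Longrightarrow> coincide (move g e (x, d)) = coincide (x, d)"
    by (rule polynomial_move_recurrence[OF fin' null fin]) (assumption, rule that)
  show ?thesis
  proof (cases "coincide (x, d) = {}")
    case True
    then have inj: "inj_on (\<lambda>p. \<chi> (x + poly p d)) P"
      by (auto simp: coincide_def T_def inj_on_def)
    have pattern: "poly_pattern ps x d = map (\<lambda>p. x + poly p d) (0 # ps)"
      by (simp add: poly_pattern_def)
    have "rainbow \<chi> (poly_pattern ps x d)"
      using inj assms(1) False unfolding rainbow_def pattern map_map distinct_map
      by (simp add: P_def comp_def)
    \<comment> \<open>At d = 0 every member of \<open>P\<close> yields the colour of x, so 0 and any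
      member of \<open>ps\<close> would coincide.\<close>
    moreover have "d \<noteq> 0"
    proof
      assume "d = 0"
      obtain p where "p \<in> set ps" using False by (cases ps) auto
      then have "p = 0" using inj_onD[OF inj, of p 0] assms(2) \<open>d = 0\<close> by (simp add: P_def)
      with \<open>p \<in> set ps\<close> False show False by blast
    qed
    ultimately show ?thesis by blast
  next
    case False
    then obtain z where z: "z \<in> coincide (x, d)" by blast
    then have "z \<in> T" by (simp add: coincide_def)
    have "linked \<chi> (fst z) (snd z) (F z) x d e"
      unfolding linked_def
    proof
      fix g assume "g \<in> F z"
      then have "z \<in> coincide (move g e (x, d))" using const[of g] z \<open>z \<in> T\<close> by blast
      then show "case move g e (x, d) of (y, d') \<Rightarrow>
          \<chi> (y + poly (fst z) d') = \<chi> (y + poly (snd z) d')"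
        by (auto simp: coincide_def split: prod.splits)
    qed
    from F(3)[OF \<open>z \<in> T\<close> \<open>0 < e\<close> this] show ?thesis by blast
  qed
qed

end
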